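(* Let $\mathscr{X}$ be a locally small well-pointed cartesian closed category, and let $\mathbb{M}$ be an $\mathscr{X}$-monad on $\underline{\mathscr{X}}$. Then $\mathbb{M}$ is commutative if and only if $$\int_y\int_x f(x,y)\,d\mu\,d\nu=\int f\,d(\mu\otimes\nu)=\int_x\int_y f(x,y)\,d\nu\,d\mu$$ for each $\mathbb{M}$-algebra $(Z,a)$, each morphism $f:X\times Y\to Z$ in $\mathscr{X}$, and each pair $(\mu,\nu)\in MX\times MY$, where $\mu\otimes\nu:=\otimes_{XY}(\mu,\nu)\in M(X\times Y)$.
   Context: Well-pointed: $\mathscr{X}(1,-):\mathscr{X}\to\mathbf{Set}$ is faithful; elements of an object $X$ are morphisms $1\to X$, and morphisms of $\mathscr{X}$ are identified with the functions they induce on elements. $\underline{\mathscr{X}}$ denotes $\mathscr{X}$ enriched in itself. For an $\mathscr{X}$-monad $\mathbb{M}=(M,\delta,\kappa)$ on $\underline{\mathscr{X}}$, let $t'_{XY}:MX\times Y\to M(X\times Y)$ be the transpose of $Y\to\underline{\mathscr{X}}(X,X\times Y)\xrightarrow{M}\underline{\mathscr{X}}(MX,M(X\times Y))$ and $t''_{XY}:X\times MY\to M(X\times Y)$ the transpose of $X\to\underline{\mathscr{X}}(Y,X\times Y)\xrightarrow{M}\underline{\mathscr{X}}(MY,M(X\times Y))$. Put $\otimes_{XY}:=\kappa\cdot Mt'_{XY}\cdot t''_{MX,Y}$ and $\widetilde{\otimes}_{XY}:=\kappa\cdot Mt''_{XY}\cdot t'_{X,MY}$, both $MX\times MY\to M(X\times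 Y)$. $\mathbb{M}$ is commutative if $\otimes_{XY}=\widetilde{\otimes}_{XY}$ for all $X,Y$. Integral. For an $\mathbb{M}$-algebra $(Z,a)$, a morphism $f:X\to Z$ and $\mu\in MX$, put $\int_x f(x)\,d\mu:=\int f\,d\mu:=(a\cdot Mf)(\mu)\in Z$. For $f:X\times Y\to Z$ and $\mu\in MX$, the function $y\mapsto\int_x f(x,y)\,d\mu$ is a morphism $Y\to Z$ in $\mathscr{X}$ (namely $y\mapsto(a\cdot Mf\cdot t'_{XY})(\mu,y)$), and similarly $x\mapsto\int_y f(x,y)\,d\nu$ for $\nu\in MY$; the iterated integrals are understood accordingly. *)

theory Defs
  imports Main
begin

section \<open>Cartesian closed categories\<close>

record ('o, 'm) cat =
  Ob :: "'o set"
  Arr :: "'m set"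
  Dom :: "'m \<Rightarrow> 'o"
  Cod :: "'m \<Rightarrow> 'o"
  Id :: "'o \<Rightarrow> 'm"
  Comp :: "'m \<Rightarrow> 'm \<Rightarrow> 'm" (infixr \<open>\<cdot>\<index>\<close> 75)

definition hom :: "('o, 'm, 'z) cat_scheme \<Rightarrow> 'o \<Rightarrow> 'o \<Rightarrow> 'm set"
  where "hom C A B = {f \<in> Arr C. Dom C f = A \<and> Cod C f = B}"

text \<open>Local smallness needs no axiom: the morphisms between two objects always form a HOL set.\<close>

locale category =
  fixes C (structure)
  assumes Dom_Ob: "f \<in> Arr C \<Longrightarrow> Dom C f \<in> Ob C"
    and Cod_Ob: "f \<in> Arr C \<Longrightarrow> Cod C f \<in> Ob C"
    and Id_hom: "A \<in> Ob C \<Longrightarrow> Id C A \<in> hom C A A"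
    and Comp_hom: "f \<in> hom C A B \<Longrightarrow> g \<in> hom C B D \<Longrightarrow> g \<cdot> f \<in> hom C A D"
    and Id_left: "f \<in> hom C A B \<Longrightarrow> Id C B \<cdot> f = f"
    and Id_right: "f \<in> hom C A B \<Longrightarrow> f \<cdot> Id C A = f"
    and Comp_assoc:
      "f \<in> hom C A B \<Longrightarrow> g \<in> hom C B D \<Longrightarrow> h \<in> hom C D E \<Longrightarrow> (h \<cdot> g) \<cdot> f = h \<cdot> g \<cdot> f"

text \<open>Terminal object, binary products and exponentials are chosen;
  \<open>Exp C A B\<close> is the internal hom from \<open>A\<close> to \<open>B\<close>, with evaluation
  \<open>Ev C A B : Exp C A B \<times> A \<rightarrow> B\<close>.\<close>

record ('o, 'm) ccc = "('o, 'm) cat" +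
  One :: "'o" (\<open>\<one>\<index>\<close>)
  Prod :: "'o \<Rightarrow> 'o \<Rightarrow> 'o"
  Fst :: "'o \<Rightarrow> 'o \<Rightarrow> 'm"
  Snd :: "'o \<Rightarrow> 'o \<Rightarrow> 'm"
  Exp :: "'o \<Rightarrow> 'o \<Rightarrow> 'o"
  Ev :: "'o \<Rightarrow> 'o \<Rightarrow> 'm"

definition bang :: "('o, 'm, 'z) ccc_scheme \<Rightarrow> 'o \<Rightarrow> 'm"
  where "bang C A = (THE h. h \<in> hom C A (One C))"

definition pair :: "('o, 'm, 'z) ccc_scheme \<Rightarrow> 'm \<Rightarrow> 'm \<Rightarrow> 'm" (\<open>\<langle>_,/ _\<rangle>\<index>\<close>)
  where "pair C f g = (THE h. h \<in> hom C (Dom C f) (Prod C (Cod C f) (Cod C g)) \<and>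
    Comp C (Fst C (Cod C f) (Cod C g)) h = f \<and> Comp C (Snd C (Cod C f) (Cod C g)) h = g)"

definition prod_mor :: "('o, 'm, 'z) ccc_scheme \<Rightarrow> 'm \<Rightarrow> 'm \<Rightarrow> 'm"
  where "prod_mor C f g = pair C (Comp C f (Fst C (Dom C f) (Dom C g)))
    (Comp C g (Snd C (Dom C f) (Dom C g)))"

definition assoc_mor :: "('o, 'm, 'z) ccc_scheme \<Rightarrow> 'o \<Rightarrow> 'o \<Rightarrow> 'o \<Rightarrow> 'm"
  where "assoc_mor C A B D =
    pair C (Comp C (Fst C A B) (Fst C (Prod C A B) D))
      (pair C (Comp C (Snd C A B) (Fst C (Prod C A B) D)) (Snd C (Prod C A B) D))"

text \<open>The transpose \<open>A \<rightarrow> Exp C B (Cod C f)\<close> of \<open>f : A \<times> B \<rightarrow> Cod C f\<close>, and conversely the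
  transpose \<open>A \<times> B \<rightarrow> D\<close> of \<open>g : A \<rightarrow> Exp C B D\<close>.\<close>

definition curry :: "('o, 'm, 'z) ccc_scheme \<Rightarrow> 'o \<Rightarrow> 'o \<Rightarrow> 'm \<Rightarrow> 'm"
  where "curry C A B f = (THE h. h \<in> hom C A (Exp C B (Cod C f)) \<and>
    Comp C (Ev C B (Cod C f)) (prod_mor C h (Id C B)) = f)"

definition uncurry :: "('o, 'm, 'z) ccc_scheme \<Rightarrow> 'o \<Rightarrow> 'o \<Rightarrow> 'm \<Rightarrow> 'm"
  where "uncurry C B D g = Comp C (Ev C B D) (prod_mor C g (Id C B))"

locale cartesian_closed_category = category C for C (structure) +
  assumes One_Ob: "\<one> \<in> Ob C"
    and One_universal: "A \<in> Ob C \<Longrightarrow> \<exists>!h. h \<in> hom C A \<one>"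
    and Prod_Ob: "A \<in> Ob C \<Longrightarrow> B \<in> Ob C \<Longrightarrow> Prod C A B \<in> Ob C"
    and Fst_hom: "A \<in> Ob C \<Longrightarrow> B \<in> Ob C \<Longrightarrow> Fst C A B \<in> hom C (Prod C A B) A"
    and Snd_hom: "A \<in> Ob C \<Longrightarrow> B \<in> Ob C \<Longrightarrow> Snd C A B \<in> hom C (Prod C A B) B"
    and Prod_universal: "f \<in> hom C D A \<Longrightarrow> g \<in> hom C D B \<Longrightarrow>
      \<exists>!h. h \<in> hom C D (Prod C A B) \<and> Fst C A B \<cdot> h = f \<and> Snd C A B \<cdot> h = g"
    and Exp_Ob: "A \<in> Ob C \<Longrightarrow> B \<in> Ob C \<Longrightarrow> Exp C A B \<in> Ob C"
    and Ev_hom: "A \<in> Ob C \<Longrightarrow> B \<in> Ob C \<Longrightarrow> Ev C A B \<in> hom C (Prod C (Exp C A B) A) B"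
    and Exp_universal: "A \<in> Ob C \<Longrightarrow> B \<in> Ob C \<Longrightarrow> f \<in> hom C (Prod C A B) D \<Longrightarrow>
      \<exists>!h. h \<in> hom C A (Exp C B D) \<and> Ev C B D \<cdot> prod_mor C h (Id C B) = f"

abbreviation elts :: "('o, 'm, 'z) ccc_scheme \<Rightarrow> 'o \<Rightarrow> 'm set"
  where "elts C A \<equiv> hom C (One C) A"

locale well_pointed_ccc = cartesian_closed_category +
  assumes faithful: "f \<in> hom C A B \<Longrightarrow> g \<in> hom C A B \<Longrightarrow>
    (\<And>x. x \<in> elts C A \<Longrightarrow> f \<cdot> x = g \<cdot> x) \<Longrightarrow> f = g"

text \<open>The morphism \<open>A \<rightarrow> B\<close> inducing a given function on elements; in a well-pointed category
  there is at most one.\<close>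

definition mor_of_fun :: "('o, 'm, 'z) ccc_scheme \<Rightarrow> 'o \<Rightarrow> 'o \<Rightarrow> ('m \<Rightarrow> 'm) \<Rightarrow> 'm"
  where "mor_of_fun C A B \<phi> = (THE g. g \<in> hom C A B \<and> (\<forall>x \<in> elts C A. Comp C g x = \<phi> x))"


section \<open>Enriched categories, functors, transformations and monads\<close>

text \<open>Categories enriched in a cartesian closed category \<open>V\<close>, regarded as monoidal by its products.
  \<open>EComp A a b c : EHom A b c \<times> EHom A a b \<rightarrow> EHom A a c\<close>.\<close>

record ('a, 'o, 'm) ecat =
  EOb :: "'a set"
  EHom :: "'a \<Rightarrow> 'a \<Rightarrow> 'o"
  EComp :: "'a \<Rightarrow> 'a \<Rightarrow> 'a \<Rightarrow> 'm"
  EId :: "'a \<Rightarrow> 'm"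

locale enriched_category = cartesian_closed_category V for V (structure) +
  fixes A :: "('a, 'o, 'm, 'y) ecat_scheme"
  assumes EHom_Ob: "a \<in> EOb A \<Longrightarrow> b \<in> EOb A \<Longrightarrow> EHom A a b \<in> Ob V"
    and EComp_hom: "a \<in> EOb A \<Longrightarrow> b \<in> EOb A \<Longrightarrow> c \<in> EOb A \<Longrightarrow>
      EComp A a b c \<in> hom V (Prod V (EHom A b c) (EHom A a b)) (EHom A a c)"
    and EId_hom: "a \<in> EOb A \<Longrightarrow> EId A a \<in> hom V \<one> (EHom A a a)"
    and EComp_assoc: "a \<in> EOb A \<Longrightarrow> b \<in> EOb A \<Longrightarrow> c \<in> EOb A \<Longrightarrow> d \<in> EOb A \<Longrightarrow>
      EComp A a b d \<cdot> prod_mor V (EComp A b c d) (Id V (EHom A a b)) =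
      EComp A a c d \<cdot> prod_mor V (Id V (EHom A c d)) (EComp A a b c) \<cdot>
        assoc_mor V (EHom A c d) (EHom A b c) (EHom A a b)"
    and EId_left: "a \<in> EOb A \<Longrightarrow> b \<in> EOb A \<Longrightarrow>
      EComp A a b b \<cdot> \<langle>EId A b \<cdot> bang V (EHom A a b), Id V (EHom A a b)\<rangle> = Id V (EHom A a b)"
    and EId_right: "a \<in> EOb A \<Longrightarrow> b \<in> EOb A \<Longrightarrow>
      EComp A a a b \<cdot> \<langle>Id V (EHom A a b), EId A a \<cdot> bang V (EHom A a b)\<rangle> = Id V (EHom A a b)"

record ('a, 'b, 'm) efun =
  FOb :: "'a \<Rightarrow> 'b"
  FHom :: "'a \<Rightarrow> 'a \<Rightarrow> 'm"

locale enriched_functor =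
  A: enriched_category V A + B: enriched_category V B for V (structure) and A and B +
  fixes F :: "('a, 'b, 'm, 'y) efun_scheme"
  assumes FOb_EOb: "a \<in> EOb A \<Longrightarrow> FOb F a \<in> EOb B"
    and FHom_hom: "a \<in> EOb A \<Longrightarrow> b \<in> EOb A \<Longrightarrow>
      FHom F a b \<in> hom V (EHom A a b) (EHom B (FOb F a) (FOb F b))"
    and FHom_EComp: "a \<in> EOb A \<Longrightarrow> b \<in> EOb A \<Longrightarrow> c \<in> EOb A \<Longrightarrow>
      FHom F a c \<cdot> EComp A a b c =
      EComp B (FOb F a) (FOb F b) (FOb F c) \<cdot> prod_mor V (FHom F b c) (FHom F a b)"
    and FHom_EId: "a \<in> EOb A \<Longrightarrow> FHom F a a \<cdot> EId A a = EId B (FOb F a)"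

definition id_efun :: "('o, 'm, 'z) ccc_scheme \<Rightarrow> ('a, 'o, 'm, 'y) ecat_scheme \<Rightarrow> ('a, 'a, 'm) efun"
  where "id_efun V A = \<lparr>FOb = (\<lambda>a. a), FHom = (\<lambda>a b. Id V (EHom A a b))\<rparr>"

definition comp_efun :: "('o, 'm, 'z) ccc_scheme \<Rightarrow> ('b, 'c, 'm, 'x) efun_scheme \<Rightarrow>
    ('a, 'b, 'm, 'y) efun_scheme \<Rightarrow> ('a, 'c, 'm) efun"
  where "comp_efun V G F = \<lparr>FOb = (\<lambda>a. FOb G (FOb F a)),
    FHom = (\<lambda>a b. Comp V (FHom G (FOb F a) (FOb F b)) (FHom F a b))\<rparr>"

text \<open>A \<open>V\<close>-natural transformation has components \<open>\<alpha> a : 1 \<rightarrow> EHom B (F a) (G a)\<close>.\<close>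

locale enriched_nat_trans =
  F: enriched_functor V A B F + G: enriched_functor V A B G
  for V (structure) and A and B and F and G +
  fixes \<alpha> :: "'a \<Rightarrow> 'm"
  assumes component_hom: "a \<in> EOb A \<Longrightarrow> \<alpha> a \<in> hom V \<one> (EHom B (FOb F a) (FOb G a))"
    and naturality: "a \<in> EOb A \<Longrightarrow> b \<in> EOb A \<Longrightarrow>
      EComp B (FOb F a) (FOb F b) (FOb G b) \<cdot> \<langle>\<alpha> b \<cdot> bang V (EHom A a b), FHom F a b\<rangle> =
      EComp B (FOb F a) (FOb G a) (FOb G b) \<cdot> \<langle>FHom G a b, \<alpha> a \<cdot> bang V (EHom A a b)\<rangle>"

record ('a, 'm) emonad = "('a, 'a, 'm) efun" +
  Unit :: "'a \<Rightarrow> 'm"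
  Mult :: "'a \<Rightarrow> 'm"

text \<open>The monad laws are equations between morphisms of the underlying ordinary category of \<open>A\<close>,
  where \<open>EComp A a b c \<cdot> \<langle>g, f\<rangle>\<close> is the composite of \<open>f : 1 \<rightarrow> EHom A a b\<close> and
  \<open>g : 1 \<rightarrow> EHom A b c\<close>.\<close>

locale enriched_monad =
  A: enriched_category V A +
  T: enriched_functor V A A T +
  Unit: enriched_nat_trans V A A "id_efun V A" T "Unit T" +
  Mult: enriched_nat_trans V A A "comp_efun V T T" T "Mult T"
  for V (structure) and A and T +
  assumes Mult_Unit_left: "a \<in> EOb A \<Longrightarrow>
      EComp A (FOb T a) (FOb T (FOb T a)) (FOb T a) \<cdot> \<langle>Mult T a, Unit T (FOb T a)\<rangle> =
      EId A (FOb T a)"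
    and Mult_Unit_right: "a \<in> EOb A \<Longrightarrow>
      EComp A (FOb T a) (FOb T (FOb T a)) (FOb T a) \<cdot> \<langle>Mult T a, FHom T a (FOb T a) \<cdot> Unit T a\<rangle> =
      EId A (FOb T a)"
    and Mult_assoc: "a \<in> EOb A \<Longrightarrow>
      EComp A (FOb T (FOb T (FOb T a))) (FOb T (FOb T a)) (FOb T a) \<cdot>
        \<langle>Mult T a, Mult T (FOb T a)\<rangle> =
      EComp A (FOb T (FOb T (FOb T a))) (FOb T (FOb T a)) (FOb T a) \<cdot>
        \<langle>Mult T a, FHom T (FOb T (FOb T a)) (FOb T a) \<cdot> Mult T a\<rangle>"


section \<open>A cartesian closed category enriched in itself\<close>

definition self_enriched :: "('o, 'm, 'z) ccc_scheme \<Rightarrow> ('o, 'o, 'm) ecat"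
  where "self_enriched C = \<lparr>
    EOb = Ob C,
    EHom = Exp C,
    EComp = (\<lambda>X Y Z. curry C (Prod C (Exp C Y Z) (Exp C X Y)) X
      (Comp C (Ev C Y Z) (Comp C (prod_mor C (Id C (Exp C Y Z)) (Ev C X Y))
        (assoc_mor C (Exp C Y Z) (Exp C X Y) X)))),
    EId = (\<lambda>X. curry C (One C) X (Snd C (One C) X))\<rparr>"

text \<open>The bijection between morphisms \<open>X \<rightarrow> Y\<close> and \<open>1 \<rightarrow> Exp C X Y\<close>.\<close>

definition mor_name :: "('o, 'm, 'z) ccc_scheme \<Rightarrow> 'm \<Rightarrow> 'm"
  where "mor_name C f = curry C (One C) (Dom C f) (Comp C f (Snd C (One C) (Dom C f)))"

definition named_mor :: "('o, 'm, 'z) ccc_scheme \<Rightarrow> 'o \<Rightarrow> 'o \<Rightarrow> 'm \<Rightarrow> 'm"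
  where "named_mor C X Y u = Comp C (uncurry C X Y u) (pair C (bang C X) (Id C X))"


section \<open>Monads on the self-enriched category\<close>

text \<open>The underlying ordinary monad: action on morphisms, unit and multiplication.\<close>

definition mmap :: "('o, 'm, 'z) ccc_scheme \<Rightarrow> ('o, 'm, 'y) emonad_scheme \<Rightarrow> 'm \<Rightarrow> 'm"
  where "mmap C M f = named_mor C (FOb M (Dom C f)) (FOb M (Cod C f))
    (Comp C (FHom M (Dom C f) (Cod C f)) (mor_name C f))"

definition munit :: "('o, 'm, 'z) ccc_scheme \<Rightarrow> ('o, 'm, 'y) emonad_scheme \<Rightarrow> 'o \<Rightarrow> 'm"
  where "munit C M X = named_mor C X (FOb M X) (Unit M X)"

definition mmult :: "('o, 'm, 'z) ccc_scheme \<Rightarrow> ('o, 'm, 'y) emonad_scheme \<Rightarrow> 'o \<Rightarrow> 'm"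
  where "mmult C M X = named_mor C (FOb M (FOb M X)) (FOb M X) (Mult M X)"

definition is_algebra ::
    "('o, 'm, 'z) ccc_scheme \<Rightarrow> ('o, 'm, 'y) emonad_scheme \<Rightarrow> 'o \<Rightarrow> 'm \<Rightarrow> bool"
  where "is_algebra C M Z a \<longleftrightarrow> Z \<in> Ob C \<and> a \<in> hom C (FOb M Z) Z \<and>
    Comp C a (munit C M Z) = Id C Z \<and> Comp C a (mmult C M Z) = Comp C a (mmap C M a)"

text \<open>\<open>strength_l C M X Y : M X \<times> Y \<rightarrow> M (X \<times> Y)\<close> and
  \<open>strength_r C M X Y : X \<times> M Y \<rightarrow> M (X \<times> Y)\<close> are the transposes of
  \<open>Y \<rightarrow> Exp C X (X \<times> Y) \<rightarrow> Exp C (M X) (M (X \<times> Y))\<close> and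
  \<open>X \<rightarrow> Exp C Y (X \<times> Y) \<rightarrow> Exp C (M Y) (M (X \<times> Y))\<close>. As \<open>curry\<close> and \<open>uncurry\<close> act on the second
  factor, the former needs the symmetry at both ends.\<close>

definition swap :: "('o, 'm, 'z) ccc_scheme \<Rightarrow> 'o \<Rightarrow> 'o \<Rightarrow> 'm"
  where "swap C A B = pair C (Snd C A B) (Fst C A B)"

definition strength_l ::
    "('o, 'm, 'z) ccc_scheme \<Rightarrow> ('o, 'm, 'y) emonad_scheme \<Rightarrow> 'o \<Rightarrow> 'o \<Rightarrow> 'm"
  where "strength_l C M X Y = Comp C
    (uncurry C (FOb M X) (FOb M (Prod C X Y))
      (Comp C (FHom M X (Prod C X Y)) (curry C Y X (swap C Y X))))
    (swap C (FOb M X) Y)"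

definition strength_r ::
    "('o, 'm, 'z) ccc_scheme \<Rightarrow> ('o, 'm, 'y) emonad_scheme \<Rightarrow> 'o \<Rightarrow> 'o \<Rightarrow> 'm"
  where "strength_r C M X Y =
    uncurry C (FOb M Y) (FOb M (Prod C X Y))
      (Comp C (FHom M Y (Prod C X Y)) (curry C X Y (Id C (Prod C X Y))))"

definition tensor ::
    "('o, 'm, 'z) ccc_scheme \<Rightarrow> ('o, 'm, 'y) emonad_scheme \<Rightarrow> 'o \<Rightarrow> 'o \<Rightarrow> 'm"
  where "tensor C M X Y = Comp C (mmult C M (Prod C X Y))
    (Comp C (mmap C M (strength_l C M X Y)) (strength_r C M (FOb M X) Y))"

definition tensor' ::
    "('o, 'm, 'z) ccc_scheme \<Rightarrow> ('o, 'm, 'y) emonad_scheme \<Rightarrow> 'o \<Rightarrow> 'o \<Rightarrow> 'm"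
  where "tensor' C M X Y = Comp C (mmult C M (Prod C X Y))
    (Comp C (mmap C M (strength_r C M X Y)) (strength_l C M X (FOb M Y)))"

definition commutative_monad :: "('o, 'm, 'z) ccc_scheme \<Rightarrow> ('o, 'm, 'y) emonad_scheme \<Rightarrow> bool"
  where "commutative_monad C M \<longleftrightarrow> (\<forall>X \<in> Ob C. \<forall>Y \<in> Ob C. tensor C M X Y = tensor' C M X Y)"


section \<open>Integrals\<close>

text \<open>\<open>integral C M a f \<mu>\<close> is the integral of a morphism \<open>f\<close>; \<open>integral_fun C M X Z a \<phi> \<mu>\<close> is the
  integral over \<open>x \<in> X\<close> of \<open>\<phi> x\<close>, for a function \<open>\<phi>\<close> on elements that is induced by a morphism
  \<open>X \<rightarrow> Z\<close>.\<close>

definition integral ::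
    "('o, 'm, 'z) ccc_scheme \<Rightarrow> ('o, 'm, 'y) emonad_scheme \<Rightarrow> 'm \<Rightarrow> 'm \<Rightarrow> 'm \<Rightarrow> 'm"
  where "integral C M a f \<mu> = Comp C (Comp C a (mmap C M f)) \<mu>"

definition integral_fun ::
    "('o, 'm, 'z) ccc_scheme \<Rightarrow> ('o, 'm, 'y) emonad_scheme \<Rightarrow> 'o \<Rightarrow> 'o \<Rightarrow> 'm \<Rightarrow> ('m \<Rightarrow> 'm) \<Rightarrow> 'm \<Rightarrow> 'm"
  where "integral_fun C M X Z a \<phi> \<mu> = integral C M a (mor_of_fun C X Z \<phi>) \<mu>"

end

theory Submission
  imports Defs
begin

text \<open>
  Write \<open>t'\<close> and \<open>t''\<close> for the strengths and \<open>\<kappa>\<close> for the multiplication. On elements,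
  \<open>t'(\<mu>, y) = M\<langle>id, y\<rangle>(\<mu>)\<close> and \<open>t''(x, \<nu>) = M\<langle>x, id\<rangle>(\<nu>)\<close>. Hence
  \<open>g = a \<cdot> M f \<cdot> t'(\<mu>, -)\<close> is the inner integral over \<open>x\<close>, and naturality of \<open>\<kappa>\<close>
  together with \<open>a \<cdot> \<kappa> = a \<cdot> M a\<close> turns \<open>a \<cdot> M f \<cdot> \<kappa> \<cdot> M t' \<cdot> t''(\<mu>, \<nu>)\<close>
  into \<open>(a \<cdot> M g)(\<nu>)\<close>. So each order of integration is, for any monad, the integral against
  one of the two tensors. Conversely, integrating the unit \<open>X \<times> Y \<rightarrow> M (X \<times> Y)\<close> in the free
  algebra on \<open>X \<times> Y\<close> recovers the tensors themselves.
\<close>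

section \<open>Typing and composition as rewrite rules\<close>

lemma homD:
  assumes "f \<in> hom C A B"
  shows "f \<in> Arr C" "Dom C f = A" "Cod C f = B"
  using assms by (auto simp: hom_def)

context category
begin

lemma Ob_of_hom:
  assumes "f \<in> hom C A B"
  shows "A \<in> Ob C" "B \<in> Ob C"
  using assms Dom_Ob Cod_Ob by (auto simp: hom_def)

lemma Arr_Id [simp]: "A \<in> Ob C \<Longrightarrow> Id C A \<in> Arr C"
  and Dom_Id [simp]: "A \<in> Ob C \<Longrightarrow> Dom C (Id C A) = A"
  and Cod_Id [simp]: "A \<in> Ob C \<Longrightarrow> Cod C (Id C A) = A"
  using Id_hom by (auto simp: hom_def)

text \<open>The \<open>hom\<close> form of the axioms mentions intermediate objects that occur only
  in the premises, so rewriting cannot find them. With \<open>Arr\<close>, \<open>Dom\<close> and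
  \<open>Cod\<close> every side condition is itself decided by simplification.\<close>

lemma Arr_Comp [simp]: "f \<in> Arr C \<Longrightarrow> g \<in> Arr C \<Longrightarrow> Dom C g = Cod C f \<Longrightarrow> g \<cdot> f \<in> Arr C"
  and Dom_Comp [simp]: "f \<in> Arr C \<Longrightarrow> g \<in> Arr C \<Longrightarrow> Dom C g = Cod C f \<Longrightarrow> Dom C (g \<cdot> f) = Dom C f"
  and Cod_Comp [simp]: "f \<in> Arr C \<Longrightarrow> g \<in> Arr C \<Longrightarrow> Dom C g = Cod C f \<Longrightarrow> Cod C (g \<cdot> f) = Cod C g"
  using Comp_hom[of f "Dom C f" "Cod C f" g "Cod C g"] by (auto simp: hom_def)

lemma Comp_Id_left [simp]: "f \<in> Arr C \<Longrightarrow> Cod C f = B \<Longrightarrow> Id C B \<cdot> f = f"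
  and Comp_Id_right [simp]: "f \<in> Arr C \<Longrightarrow> Dom C f = A \<Longrightarrow> f \<cdot> Id C A = f"
  using Id_left[of f "Dom C f" "Cod C f"] Id_right[of f "Dom C f" "Cod C f"]
  by (auto simp: hom_def)

text \<open>Fixes bracketing to the right as the normal form; proofs that need the other bracketing
  have to restore it explicitly.\<close>

lemma Comp_Comp [simp]:
  "\<lbrakk>f \<in> Arr C; g \<in> Arr C; h \<in> Arr C; Dom C g = Cod C f; Dom C h = Cod C g\<rbrakk>
    \<Longrightarrow> (h \<cdot> g) \<cdot> f = h \<cdot> g \<cdot> f"
  using Comp_assoc[of f "Dom C f" "Cod C f" g "Cod C g" h "Cod C h"] by (auto simp: hom_def)

end

section \<open>Products, exponentials and names of morphisms\<close>

context cartesian_closed_category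
begin

lemmas Ob_simps [simp] = One_Ob Prod_Ob Exp_Ob Dom_Ob Cod_Ob

lemma Arr_Fst [simp]: "A \<in> Ob C \<Longrightarrow> B \<in> Ob C \<Longrightarrow> Fst C A B \<in> Arr C"
  and Dom_Fst [simp]: "A \<in> Ob C \<Longrightarrow> B \<in> Ob C \<Longrightarrow> Dom C (Fst C A B) = Prod C A B"
  and Cod_Fst [simp]: "A \<in> Ob C \<Longrightarrow> B \<in> Ob C \<Longrightarrow> Cod C (Fst C A B) = A"
  using Fst_hom by (auto simp: hom_def)

lemma Arr_Snd [simp]: "A \<in> Ob C \<Longrightarrow> B \<in> Ob C \<Longrightarrow> Snd C A B \<in> Arr C"
  and Dom_Snd [simp]: "A \<in> Ob C \<Longrightarrow> B \<in> Ob C \<Longrightarrow> Dom C (Snd C A B) = Prod C A B"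
  and Cod_Snd [simp]: "A \<in> Ob C \<Longrightarrow> B \<in> Ob C \<Longrightarrow> Cod C (Snd C A B) = B"
  using Snd_hom by (auto simp: hom_def)

lemma Arr_Ev [simp]: "A \<in> Ob C \<Longrightarrow> B \<in> Ob C \<Longrightarrow> Ev C A B \<in> Arr C"
  and Dom_Ev [simp]: "A \<in> Ob C \<Longrightarrow> B \<in> Ob C \<Longrightarrow> Dom C (Ev C A B) = Prod C (Exp C A B) A"
  and Cod_Ev [simp]: "A \<in> Ob C \<Longrightarrow> B \<in> Ob C \<Longrightarrow> Cod C (Ev C A B) = B"
  using Ev_hom by (auto simp: hom_def)

lemma bang_hom: "A \<in> Ob C \<Longrightarrow> bang C A \<in> hom C A \<one>"
  unfolding bang_def by (rule theI') (rule One_universal)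

lemma Arr_bang [simp]: "A \<in> Ob C \<Longrightarrow> bang C A \<in> Arr C"
  and Dom_bang [simp]: "A \<in> Ob C \<Longrightarrow> Dom C (bang C A) = A"
  and Cod_bang [simp]: "A \<in> Ob C \<Longrightarrow> Cod C (bang C A) = \<one>"
  using bang_hom by (auto simp: hom_def)

lemma bang_unique: "f \<in> hom C A \<one> \<Longrightarrow> f = bang C A"
  using One_universal bang_hom Ob_of_hom by blast

lemma bang_Comp [simp]: "f \<in> Arr C \<Longrightarrow> Cod C f = A \<Longrightarrow> bang C A \<cdot> f = bang C (Dom C f)"
  by (rule bang_unique) (auto simp: hom_def)

lemma bang_One [simp]: "bang C \<one> = Id C \<one>"
  by (rule bang_unique[symmetric]) (auto simp: hom_def)

lemma pair_universal:
  assumes "f \<in> Arr C" "g \<in> Arr C" "Dom C f = Dom C g"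
  shows "\<langle>f, g\<rangle> \<in> hom C (Dom C f) (Prod C (Cod C f) (Cod C g)) \<and>
    Fst C (Cod C f) (Cod C g) \<cdot> \<langle>f, g\<rangle> = f \<and> Snd C (Cod C f) (Cod C g) \<cdot> \<langle>f, g\<rangle> = g"
  unfolding pair_def
  by (rule theI') (rule Prod_universal; use assms in \<open>simp add: hom_def\<close>)

lemma
  assumes "f \<in> Arr C" "g \<in> Arr C" "Dom C f = Dom C g"
  shows Arr_pair [simp]: "\<langle>f, g\<rangle> \<in> Arr C"
    and Dom_pair [simp]: "Dom C \<langle>f, g\<rangle> = Dom C f"
    and Cod_pair [simp]: "Cod C \<langle>f, g\<rangle> = Prod C (Cod C f) (Cod C g)"
  using pair_universal[OF assms] by (auto simp: hom_def)

lemma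
  assumes "f \<in> Arr C" "g \<in> Arr C" "Dom C f = Dom C g" "Cod C f = A" "Cod C g = B"
  shows Fst_pair [simp]: "Fst C A B \<cdot> \<langle>f, g\<rangle> = f"
    and Snd_pair [simp]: "Snd C A B \<cdot> \<langle>f, g\<rangle> = g"
  using pair_universal[of f g] assms by auto

text \<open>Both sides mediate the same two projections, so the universal property of the product
  identifies them.\<close>

lemma pair_unique:
  assumes "h \<in> hom C D (Prod C A B)" "A \<in> Ob C" "B \<in> Ob C"
  shows "\<langle>Fst C A B \<cdot> h, Snd C A B \<cdot> h\<rangle> = h"
proof -
  have h: "h \<in> Arr C" "Dom C h = D" "Cod C h = Prod C A B"
    using homD[OF assms(1)] .
  have "\<exists>!k. k \<in> hom C D (Prod C A B) \<and> Fst C A B \<cdot> k = Fst C A B \<cdot> h \<and> Snd C A B \<cdot> k = Snd C A B \<cdot> h"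
    by (rule Prod_universal) (use h assms(2,3) in \<open>auto simp: hom_def\<close>)
  moreover have "\<langle>Fst C A B \<cdot> h, Snd C A B \<cdot> h\<rangle> \<in> hom C D (Prod C A B)"
    using h assms(2,3) by (simp add: hom_def)
  moreover have "Fst C A B \<cdot> \<langle>Fst C A B \<cdot> h, Snd C A B \<cdot> h\<rangle> = Fst C A B \<cdot> h"
    "Snd C A B \<cdot> \<langle>Fst C A B \<cdot> h, Snd C A B \<cdot> h\<rangle> = Snd C A B \<cdot> h"
    using h assms(2,3) by simp_all
  ultimately show ?thesis
    using assms(1) by blast
qed

lemma pair_Comp [simp]:
  assumes "f \<in> Arr C" "g \<in> Arr C" "h \<in> Arr C" "Dom C f = Cod C h" "Dom C g = Cod C h"
  shows "\<langle>f, g\<rangle> \<cdot> h = \<langle>f \<cdot> h, g \<cdot> h\<rangle>"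
proof -
  let ?A = "Cod C f" and ?B = "Cod C g"
  have "\<langle>Fst C ?A ?B \<cdot> \<langle>f, g\<rangle> \<cdot> h, Snd C ?A ?B \<cdot> \<langle>f, g\<rangle> \<cdot> h\<rangle> = \<langle>f, g\<rangle> \<cdot> h"
    by (rule pair_unique) (use assms in \<open>auto simp: hom_def\<close>)
  \<comment> \<open>The projection laws see only a projection applied directly to the pair, hence
    the temporary bracketing to the left.\<close>
  moreover have "Fst C ?A ?B \<cdot> \<langle>f, g\<rangle> \<cdot> h = f \<cdot> h" "Snd C ?A ?B \<cdot> \<langle>f, g\<rangle> \<cdot> h = g \<cdot> h"
    using assms by (simp_all flip: Comp_Comp)
  ultimately show ?thesis by simp
qed

text \<open>By the eta law \<open>pair_unique\<close>; it allows morphisms out of a product to be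
  tested on pairs of elements.\<close>

lemma elts_Prod_cases:
  assumes "z \<in> elts C (Prod C A B)" "A \<in> Ob C" "B \<in> Ob C"
  obtains x y where "x \<in> elts C A" "y \<in> elts C B" "z = \<langle>x, y\<rangle>"
proof
  show "Fst C A B \<cdot> z \<in> elts C A" "Snd C A B \<cdot> z \<in> elts C B"
    using assms by (auto simp: hom_def)
  show "z = \<langle>Fst C A B \<cdot> z, Snd C A B \<cdot> z\<rangle>"
    using pair_unique[OF assms] by simp
qed

lemma
  assumes "f \<in> Arr C" "g \<in> Arr C"
  shows Arr_prod_mor [simp]: "prod_mor C f g \<in> Arr C"
    and Dom_prod_mor [simp]: "Dom C (prod_mor C f g) = Prod C (Dom C f) (Dom C g)"
    and Cod_prod_mor [simp]: "Cod C (prod_mor C f g) = Prod C (Cod C f) (Cod C g)"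
  using assms by (simp_all add: prod_mor_def)

lemma prod_mor_pair [simp]:
  assumes "f \<in> Arr C" "g \<in> Arr C" "x \<in> Arr C" "y \<in> Arr C" "Dom C x = Dom C y"
    "Dom C f = Cod C x" "Dom C g = Cod C y"
  shows "prod_mor C f g \<cdot> \<langle>x, y\<rangle> = \<langle>f \<cdot> x, g \<cdot> y\<rangle>"
  using assms by (simp add: prod_mor_def)

lemma curry_universal:
  assumes "A \<in> Ob C" "B \<in> Ob C" "f \<in> Arr C" "Dom C f = Prod C A B"
  shows "curry C A B f \<in> hom C A (Exp C B (Cod C f)) \<and>
    Ev C B (Cod C f) \<cdot> prod_mor C (curry C A B f) (Id C B) = f"
  unfolding curry_def
  by (rule theI') (rule Exp_universal; use assms in \<open>simp add: hom_def\<close>)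

lemma
  assumes "A \<in> Ob C" "B \<in> Ob C" "f \<in> Arr C" "Dom C f = Prod C A B"
  shows Arr_curry [simp]: "curry C A B f \<in> Arr C"
    and Dom_curry [simp]: "Dom C (curry C A B f) = A"
    and Cod_curry [simp]: "Cod C (curry C A B f) = Exp C B (Cod C f)"
  using curry_universal[OF assms] by (auto simp: hom_def)

text \<open>The beta law for generalized elements \<open>x\<close> and \<open>y\<close>. The
  universal property is phrased with \<open>prod_mor\<close>, which simplification dissolves into
  pairs, so the law is restated for pairs.\<close>

lemma Ev_curry [simp]:
  assumes "A \<in> Ob C" "B \<in> Ob C" "f \<in> Arr C" "Dom C f = Prod C A B" "Cod C f = D"
    "x \<in> Arr C" "y \<in> Arr C" "Dom C x = Dom C y" "Cod C x = A" "Cod C y = B"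
  shows "Ev C B D \<cdot> \<langle>curry C A B f \<cdot> x, y\<rangle> = f \<cdot> \<langle>x, y\<rangle>"
proof -
  have "Ev C B D \<cdot> \<langle>curry C A B f \<cdot> x, y\<rangle> = Ev C B D \<cdot> prod_mor C (curry C A B f) (Id C B) \<cdot> \<langle>x, y\<rangle>"
    using assms by simp
  also have "\<dots> = (Ev C B D \<cdot> prod_mor C (curry C A B f) (Id C B)) \<cdot> \<langle>x, y\<rangle>"
    using assms by (subst Comp_Comp) auto
  also have "\<dots> = f \<cdot> \<langle>x, y\<rangle>"
    using curry_universal[of A B f] assms by simp
  finally show ?thesis .
qed

text \<open>The case \<open>x = Id C \<one>\<close>: the identity is simplified away, so the pattern
  of \<open>Ev_curry\<close> no longer matches.\<close>

lemma Ev_curry_One [simp]: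
  assumes "B \<in> Ob C" "f \<in> Arr C" "Dom C f = Prod C \<one> B" "Cod C f = D" "y \<in> elts C B"
  shows "Ev C B D \<cdot> \<langle>curry C \<one> B f, y\<rangle> = f \<cdot> \<langle>Id C \<one>, y\<rangle>"
  using Ev_curry[of \<one> B f D "Id C \<one>" y] assms by (simp add: hom_def)

lemma
  assumes "g \<in> Arr C" "Cod C g = Exp C B D" "B \<in> Ob C" "D \<in> Ob C"
  shows Arr_uncurry [simp]: "uncurry C B D g \<in> Arr C"
    and Dom_uncurry [simp]: "Dom C (uncurry C B D g) = Prod C (Dom C g) B"
    and Cod_uncurry [simp]: "Cod C (uncurry C B D g) = D"
  using assms by (simp_all add: uncurry_def)

lemma uncurry_pair [simp]:
  assumes "g \<in> Arr C" "Cod C g = Exp C B D" "B \<in> Ob C" "D \<in> Ob C"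
    "x \<in> Arr C" "y \<in> Arr C" "Dom C x = Dom C y" "Cod C x = Dom C g" "Cod C y = B"
  shows "uncurry C B D g \<cdot> \<langle>x, y\<rangle> = Ev C B D \<cdot> \<langle>g \<cdot> x, y\<rangle>"
  using assms by (simp add: uncurry_def)

lemma
  assumes "A \<in> Ob C" "B \<in> Ob C"
  shows Arr_swap [simp]: "swap C A B \<in> Arr C"
    and Dom_swap [simp]: "Dom C (swap C A B) = Prod C A B"
    and Cod_swap [simp]: "Cod C (swap C A B) = Prod C B A"
  using assms by (simp_all add: swap_def)

lemma swap_pair [simp]:
  assumes "x \<in> Arr C" "y \<in> Arr C" "Dom C x = Dom C y" "Cod C x = A" "Cod C y = B"
  shows "swap C A B \<cdot> \<langle>x, y\<rangle> = \<langle>y, x\<rangle>"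
  using assms by (auto simp: swap_def)

lemma assoc_mor_pair [simp]:
  assumes "x \<in> Arr C" "y \<in> Arr C" "z \<in> Arr C" "Dom C x = Dom C z" "Dom C y = Dom C z"
    "Cod C x = A" "Cod C y = B" "Cod C z = D"
  shows "assoc_mor C A B D \<cdot> \<langle>\<langle>x, y\<rangle>, z\<rangle> = \<langle>x, \<langle>y, z\<rangle>\<rangle>"
  using assms by (auto simp: assoc_mor_def)

lemma
  assumes "A \<in> Ob C" "B \<in> Ob C" "D \<in> Ob C"
  shows Arr_assoc_mor [simp]: "assoc_mor C A B D \<in> Arr C"
    and Dom_assoc_mor [simp]: "Dom C (assoc_mor C A B D) = Prod C (Prod C A B) D"
    and Cod_assoc_mor [simp]: "Cod C (assoc_mor C A B D) = Prod C A (Prod C B D)"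
  using assms by (simp_all add: assoc_mor_def)

lemma mor_name_hom:
  assumes "f \<in> hom C A B"
  shows "mor_name C f \<in> elts C (Exp C A B)"
  using assms by (auto simp: mor_name_def hom_def)

lemma
  assumes "f \<in> Arr C"
  shows Arr_mor_name [simp]: "mor_name C f \<in> Arr C"
    and Dom_mor_name [simp]: "Dom C (mor_name C f) = \<one>"
    and Cod_mor_name [simp]: "Cod C (mor_name C f) = Exp C (Dom C f) (Cod C f)"
  using mor_name_hom[of f "Dom C f" "Cod C f"] assms by (auto simp: hom_def)

lemma Ev_mor_name:
  assumes "f \<in> hom C A B" "x \<in> elts C A"
  shows "Ev C A B \<cdot> \<langle>mor_name C f, x\<rangle> = f \<cdot> x"
  using assms by (auto simp: mor_name_def hom_def)

lemma named_mor_hom: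
  assumes "u \<in> elts C (Exp C A B)" "A \<in> Ob C" "B \<in> Ob C"
  shows "named_mor C A B u \<in> hom C A B"
  using assms by (auto simp: named_mor_def hom_def)

lemma named_mor_Comp:
  assumes "u \<in> elts C (Exp C A B)" "A \<in> Ob C" "B \<in> Ob C" "x \<in> elts C A"
  shows "named_mor C A B u \<cdot> x = Ev C A B \<cdot> \<langle>u, x\<rangle>"
  using assms by (auto simp: named_mor_def hom_def)

section \<open>The self-enrichment, evaluated on elements\<close>

lemma EId_self_elt: "X \<in> Ob C \<Longrightarrow> EId (self_enriched C) X \<in> elts C (Exp C X X)"
  by (simp add: self_enriched_def hom_def)

lemma Ev_EId_self:
  assumes "x \<in> elts C X"
  shows "Ev C X X \<cdot> \<langle>EId (self_enriched C) X, x\<rangle> = x"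
  using assms by (auto simp: self_enriched_def hom_def)

text \<open>The enriched composition is a transpose, so the beta law removes the
  \<open>curry\<close>, and reassociating the pair leaves two successive evaluations.\<close>

lemma Ev_EComp_self:
  assumes "v \<in> elts C (Exp C X Y)" "u \<in> elts C (Exp C Y Z)" "x \<in> elts C X"
    "X \<in> Ob C" "Y \<in> Ob C" "Z \<in> Ob C"
  shows "Ev C X Z \<cdot> \<langle>EComp (self_enriched C) X Y Z \<cdot> \<langle>u, v\<rangle>, x\<rangle> = Ev C Y Z \<cdot> \<langle>u, Ev C X Y \<cdot> \<langle>v, x\<rangle>\<rangle>"
  using assms by (auto simp: self_enriched_def hom_def)

end

lemma EOb_self [simp]: "EOb (self_enriched C) = Ob C"
  and EHom_self [simp]: "EHom (self_enriched C) = Exp C"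
  by (simp_all add: self_enriched_def)

section \<open>Consequences of well-pointedness\<close>

lemma (in well_pointed_ccc) mor_of_fun_eq:
  assumes "g \<in> hom C A B" "\<And>x. x \<in> elts C A \<Longrightarrow> g \<cdot> x = \<phi> x"
  shows "mor_of_fun C A B \<phi> = g"
  unfolding mor_of_fun_def
proof (rule the_equality)
  fix h assume "h \<in> hom C A B \<and> (\<forall>x\<in>elts C A. h \<cdot> x = \<phi> x)"
  then show "h = g"
    using assms by - (rule faithful[of h A B g], auto)
qed (use assms in auto)

lemma (in well_pointed_ccc) prod_mor_ext:
  assumes "f \<in> hom C (Prod C A B) D" "g \<in> hom C (Prod C A B) D" "A \<in> Ob C" "B \<in> Ob C"
    "\<And>x y. x \<in> elts C A \<Longrightarrow> y \<in> elts C B \<Longrightarrow> f \<cdot> \<langle>x, y\<rangle> = g \<cdot> \<langle>x, y\<rangle>"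
  shows "f = g"
proof (rule faithful)
  fix z assume "z \<in> elts C (Prod C A B)"
  then show "f \<cdot> z = g \<cdot> z"
    using assms(3-5) by (elim elts_Prod_cases) auto
qed (use assms in auto)

text \<open>The transposes of \<open>u\<close> and \<open>v\<close> are morphisms
  \<open>\<one> \<times> A \<rightarrow> B\<close> that agree on pairs of elements, hence are equal;
  uniqueness of transposes then gives \<open>u = v\<close>.\<close>

lemma (in well_pointed_ccc) elts_Exp_ext:
  assumes "u \<in> elts C (Exp C A B)" "v \<in> elts C (Exp C A B)" "A \<in> Ob C" "B \<in> Ob C"
    "\<And>x. x \<in> elts C A \<Longrightarrow> Ev C A B \<cdot> \<langle>u, x\<rangle> = Ev C A B \<cdot> \<langle>v, x\<rangle>"
  shows "u = v"
proof -
  have "Ev C A B \<cdot> prod_mor C u (Id C A) = Ev C A B \<cdot> prod_mor C v (Id C A)"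
  proof (rule prod_mor_ext)
    fix t x assume "t \<in> elts C \<one>" "x \<in> elts C A"
    \<comment> \<open>The only element of the terminal object is its identity.\<close>
    moreover from this have "t = Id C \<one>"
      using bang_unique by fastforce
    ultimately show "(Ev C A B \<cdot> prod_mor C u (Id C A)) \<cdot> \<langle>t, x\<rangle> =
        (Ev C A B \<cdot> prod_mor C v (Id C A)) \<cdot> \<langle>t, x\<rangle>"
      using assms by (simp add: hom_def)
  qed (use assms in \<open>auto simp: hom_def\<close>)
  moreover have "Ev C A B \<cdot> prod_mor C v (Id C A) \<in> hom C (Prod C \<one> A) B"
    using assms by (simp add: hom_def)
  ultimately show ?thesis
    using Exp_universal[of \<one> A _ B] assms(1-3) One_Ob by blast
qed

context well_pointed_ccc
begin

text \<open>On elements, \<open>named_mor\<close> is evaluation at the given name, and evaluating at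
  the name of \<open>f\<close> is applying \<open>f\<close>. Faithfulness gives this half of the
  bijection, \<open>elts_Exp_ext\<close> the other half.\<close>

lemma named_mor_mor_name:
  assumes "f \<in> hom C A B"
  shows "named_mor C A B (mor_name C f) = f"
  using assms Ob_of_hom[OF assms]
  by - (rule faithful[of _ A B], simp_all add: named_mor_hom mor_name_hom named_mor_Comp Ev_mor_name)

lemma mor_name_named_mor:
  assumes "u \<in> elts C (Exp C A B)" "A \<in> Ob C" "B \<in> Ob C"
  shows "mor_name C (named_mor C A B u) = u"
  using assms
  by - (rule elts_Exp_ext[of _ A B],
      simp_all add: mor_name_hom named_mor_hom named_mor_Comp Ev_mor_name)

lemma EComp_self_elt:
  assumes "v \<in> elts C (Exp C X Y)" "u \<in> elts C (Exp C Y Z)" "X \<in> Ob C" "Y \<in> Ob C" "Z \<in> Ob C"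
  shows "EComp (self_enriched C) X Y Z \<cdot> \<langle>u, v\<rangle> \<in> elts C (Exp C X Z)"
  using assms by (simp add: self_enriched_def hom_def)

text \<open>The bridge from enriched to ordinary equations: applying \<open>named_mor\<close> to
  both sides of an enriched law turns each \<open>EComp\<close> into a composite. Both sides here
  evaluate an element \<open>x\<close> first at \<open>v\<close>, then at \<open>u\<close>.\<close>

lemma named_mor_EComp:
  assumes "v \<in> elts C (Exp C X Y)" "u \<in> elts C (Exp C Y Z)" "X \<in> Ob C" "Y \<in> Ob C" "Z \<in> Ob C"
  shows "named_mor C X Z (EComp (self_enriched C) X Y Z \<cdot> \<langle>u, v\<rangle>) =
    named_mor C Y Z u \<cdot> named_mor C X Y v"
proof (rule faithful)
  note uv = named_mor_hom[OF assms(1,3,4)] named_mor_hom[OF assms(2,4,5)]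
  show "named_mor C X Z (EComp (self_enriched C) X Y Z \<cdot> \<langle>u, v\<rangle>) \<in> hom C X Z"
    by (intro named_mor_hom EComp_self_elt assms)
  show "named_mor C Y Z u \<cdot> named_mor C X Y v \<in> hom C X Z"
    by (rule Comp_hom[OF uv])
  fix x assume x: "x \<in> elts C X"
  then have "named_mor C X Y v \<cdot> x \<in> elts C Y"
    using Comp_hom uv(1) by blast
  moreover have "(named_mor C Y Z u \<cdot> named_mor C X Y v) \<cdot> x =
      named_mor C Y Z u \<cdot> named_mor C X Y v \<cdot> x"
    by (rule Comp_assoc[OF x uv])
  ultimately show "named_mor C X Z (EComp (self_enriched C) X Y Z \<cdot> \<langle>u, v\<rangle>) \<cdot> x =
      (named_mor C Y Z u \<cdot> named_mor C X Y v) \<cdot> x"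
    using assms x by (simp add: named_mor_Comp EComp_self_elt Ev_EComp_self)
qed

lemma named_mor_EId:
  assumes "X \<in> Ob C"
  shows "named_mor C X X (EId (self_enriched C) X) = Id C X"
  using assms
  by - (rule faithful[of _ X X],
      auto simp: named_mor_hom named_mor_Comp EId_self_elt Ev_EId_self Id_hom Id_left)

end

section \<open>The underlying ordinary monad\<close>

locale well_pointed_monad =
  well_pointed_ccc C + enriched_monad C "self_enriched C" M for C (structure) and M
begin

lemma FOb_Ob [simp]: "X \<in> Ob C \<Longrightarrow> FOb M X \<in> Ob C"
  using T.FOb_EOb by simp

lemma Arr_FHom [simp]: "X \<in> Ob C \<Longrightarrow> Y \<in> Ob C \<Longrightarrow> FHom M X Y \<in> Arr C"
  and Dom_FHom [simp]: "X \<in> Ob C \<Longrightarrow> Y \<in> Ob C \<Longrightarrow> Dom C (FHom M X Y) = Exp C X Y"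
  and Cod_FHom [simp]: "X \<in> Ob C \<Longrightarrow> Y \<in> Ob C \<Longrightarrow>
    Cod C (FHom M X Y) = Exp C (FOb M X) (FOb M Y)"
  using T.FHom_hom by (auto simp: hom_def)

lemma FHom_elt:
  assumes "u \<in> elts C (Exp C X Y)" "X \<in> Ob C" "Y \<in> Ob C"
  shows "FHom M X Y \<cdot> u \<in> elts C (Exp C (FOb M X) (FOb M Y))"
  using assms by (simp add: hom_def)

text \<open>\<open>mmap\<close> is \<open>FHom\<close> conjugated by naming, so the inner round trip
  cancels by \<open>mor_name_named_mor\<close>.\<close>

lemma named_mor_FHom:
  assumes "u \<in> elts C (Exp C X Y)" "X \<in> Ob C" "Y \<in> Ob C"
  shows "named_mor C (FOb M X) (FOb M Y) (FHom M X Y \<cdot> u) = mmap C M (named_mor C X Y u)"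
  using assms homD[OF named_mor_hom[OF assms]] by (simp add: mmap_def mor_name_named_mor)

lemma mmap_hom:
  assumes "f \<in> hom C X Y"
  shows "mmap C M f \<in> hom C (FOb M X) (FOb M Y)"
  using assms Ob_of_hom[OF assms] homD[OF assms]
  by (simp add: mmap_def named_mor_hom FHom_elt mor_name_hom)

lemma
  assumes "f \<in> Arr C"
  shows Arr_mmap [simp]: "mmap C M f \<in> Arr C"
    and Dom_mmap [simp]: "Dom C (mmap C M f) = FOb M (Dom C f)"
    and Cod_mmap [simp]: "Cod C (mmap C M f) = FOb M (Cod C f)"
  using mmap_hom[of f "Dom C f" "Cod C f"] assms by (auto simp: hom_def)

text \<open>Enriched functoriality, evaluated at the pair of the names of \<open>g\<close> and
  \<open>f\<close>.\<close>

lemma mmap_Comp [simp]: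
  assumes "f \<in> Arr C" "g \<in> Arr C" "Dom C g = Cod C f"
  shows "mmap C M (g \<cdot> f) = mmap C M g \<cdot> mmap C M f"
proof -
  define X Y Z where "X = Dom C f" and "Y = Cod C f" and "Z = Cod C g"
  have f: "f \<in> hom C X Y" and g: "g \<in> hom C Y Z"
    using assms by (auto simp: X_def Y_def Z_def hom_def)
  have Ob: "X \<in> Ob C" "Y \<in> Ob C" "Z \<in> Ob C"
    using Ob_of_hom f g by auto
  note nf = mor_name_hom[OF f] and ng = mor_name_hom[OF g]
  let ?E = "EComp (self_enriched C)"
  have "mmap C M (g \<cdot> f) = mmap C M (named_mor C X Z (?E X Y Z \<cdot> \<langle>mor_name C g, mor_name C f\<rangle>))"
    using Ob nf ng f g by (simp add: named_mor_EComp named_mor_mor_name)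
  also have "\<dots> = named_mor C (FOb M X) (FOb M Z)
      (FHom M X Z \<cdot> ?E X Y Z \<cdot> \<langle>mor_name C g, mor_name C f\<rangle>)"
    using Ob nf ng by (simp add: named_mor_FHom EComp_self_elt)
  \<comment> \<open>This bracketing exposes the left side of \<open>FHom_EComp\<close>.\<close>
  also have "FHom M X Z \<cdot> ?E X Y Z \<cdot> \<langle>mor_name C g, mor_name C f\<rangle> =
      (FHom M X Z \<cdot> ?E X Y Z) \<cdot> \<langle>mor_name C g, mor_name C f\<rangle>"
    by (rule Comp_assoc[symmetric])
      (use Ob nf ng T.FHom_hom[of X Z] A.EComp_hom[of X Y Z] in \<open>auto simp: hom_def\<close>)
  also have "\<dots> = (?E (FOb M X) (FOb M Y) (FOb M Z) \<cdot> prod_mor C (FHom M Y Z) (FHom M X Y)) \<cdot>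
      \<langle>mor_name C g, mor_name C f\<rangle>"
    using Ob T.FHom_EComp[of X Y Z] by simp
  also have "\<dots> = ?E (FOb M X) (FOb M Y) (FOb M Z) \<cdot>
      \<langle>FHom M Y Z \<cdot> mor_name C g, FHom M X Y \<cdot> mor_name C f\<rangle>"
    using Ob nf ng A.EComp_hom[of "FOb M X" "FOb M Y" "FOb M Z"] by (simp add: hom_def)
  also have "named_mor C (FOb M X) (FOb M Z) \<dots> = mmap C M g \<cdot> mmap C M f"
    using Ob nf ng f g by (simp add: named_mor_EComp FHom_elt named_mor_FHom named_mor_mor_name)
  finally show ?thesis .
qed

lemma Unit_elt: "X \<in> Ob C \<Longrightarrow> Unit M X \<in> elts C (Exp C X (FOb M X))"
  using Unit.component_hom[of X] by (simp add: id_efun_def)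

lemma Mult_elt: "X \<in> Ob C \<Longrightarrow> Mult M X \<in> elts C (Exp C (FOb M (FOb M X)) (FOb M X))"
  using Mult.component_hom[of X] by (simp add: comp_efun_def)

lemma munit_hom: "X \<in> Ob C \<Longrightarrow> munit C M X \<in> hom C X (FOb M X)"
  by (simp add: munit_def named_mor_hom Unit_elt)

lemma mmult_hom: "X \<in> Ob C \<Longrightarrow> mmult C M X \<in> hom C (FOb M (FOb M X)) (FOb M X)"
  by (simp add: mmult_def named_mor_hom Mult_elt)

lemma Arr_mmult [simp]: "X \<in> Ob C \<Longrightarrow> mmult C M X \<in> Arr C"
  and Dom_mmult [simp]: "X \<in> Ob C \<Longrightarrow> Dom C (mmult C M X) = FOb M (FOb M X)"
  and Cod_mmult [simp]: "X \<in> Ob C \<Longrightarrow> Cod C (mmult C M X) = FOb M X"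
  using mmult_hom by (auto simp: hom_def)

text \<open>Enriched naturality of the multiplication, evaluated at the name of \<open>f\<close> and
  translated by \<open>named_mor\<close>.\<close>

lemma mmult_natural:
  assumes "f \<in> hom C X Y"
  shows "mmap C M f \<cdot> mmult C M X = mmult C M Y \<cdot> mmap C M (mmap C M f)"
proof -
  have Ob: "X \<in> Ob C" "Y \<in> Ob C"
    using Ob_of_hom assms by auto
  let ?n = "mor_name C f" and ?M = "FOb M" and ?E = "EComp (self_enriched C)"
  note n = mor_name_hom[OF assms]
  \<comment> \<open>The two sides of the naturality square pass through different intermediate
    objects; \<open>A\<close> will be \<open>M X\<close> and \<open>M (M Y)\<close>.\<close>
  have E: "?E (?M (?M X)) A (?M Y) \<in>
      hom C (Prod C (Exp C A (?M Y)) (Exp C (?M (?M X)) A)) (Exp C (?M (?M X)) (?M Y))"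
    if "A \<in> Ob C" for A
    using that A.EComp_hom Ob by simp
  have "(?E (?M (?M X)) (?M (?M Y)) (?M Y) \<cdot>
        \<langle>Mult M Y \<cdot> bang C (Exp C X Y), FHom M (?M X) (?M Y) \<cdot> FHom M X Y\<rangle>) \<cdot> ?n =
      (?E (?M (?M X)) (?M X) (?M Y) \<cdot> \<langle>FHom M X Y, Mult M X \<cdot> bang C (Exp C X Y)\<rangle>) \<cdot> ?n"
    using Mult.naturality[of X Y] Ob by (simp add: comp_efun_def)
  \<comment> \<open>\<open>bang\<close> after the name of \<open>f\<close> is the identity of
    \<open>\<one>\<close>, so the constant components shrink to \<open>Mult\<close> itself.\<close>
  then have "?E (?M (?M X)) (?M (?M Y)) (?M Y) \<cdot> \<langle>Mult M Y, FHom M (?M X) (?M Y) \<cdot> FHom M X Y \<cdot> ?n\<rangle> =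
      ?E (?M (?M X)) (?M X) (?M Y) \<cdot> \<langle>FHom M X Y \<cdot> ?n, Mult M X\<rangle>"
    using E[of "?M X"] E[of "?M (?M Y)"] Ob n Mult_elt[of X] Mult_elt[of Y] by (simp add: hom_def)
  from arg_cong[OF this, of "named_mor C (?M (?M X)) (?M Y)"] show ?thesis
    using Ob n assms
    by (simp add: named_mor_EComp Mult_elt FHom_elt named_mor_FHom named_mor_mor_name mmult_def)
qed

text \<open>The enriched law equates two elements of an internal hom; \<open>named_mor\<close>
  carries it to the ordinary law. The other unit law and associativity below are obtained in the
  same way.\<close>

lemma mmult_munit:
  assumes "X \<in> Ob C"
  shows "mmult C M X \<cdot> munit C M (FOb M X) = Id C (FOb M X)"
  using arg_cong[OF Mult_Unit_left[of X], of "named_mor C (FOb M X) (FOb M X)"] assms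
  by (simp add: named_mor_EComp Mult_elt Unit_elt named_mor_EId mmult_def munit_def)

lemma mmult_mmap_munit:
  assumes "X \<in> Ob C"
  shows "mmult C M X \<cdot> mmap C M (munit C M X) = Id C (FOb M X)"
  using arg_cong[OF Mult_Unit_right[of X], of "named_mor C (FOb M X) (FOb M X)"] assms
  by (simp add: named_mor_EComp Mult_elt Unit_elt named_mor_EId FHom_elt named_mor_FHom
      mmult_def munit_def)

lemma mmult_mmult:
  assumes "X \<in> Ob C"
  shows "mmult C M X \<cdot> mmult C M (FOb M X) = mmult C M X \<cdot> mmap C M (mmult C M X)"
  using arg_cong[OF Mult_assoc[of X], of "named_mor C (FOb M (FOb M (FOb M X))) (FOb M X)"] assms
  by (simp add: named_mor_EComp Mult_elt FHom_elt named_mor_FHom mmult_def)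

text \<open>The test algebra for the converse direction.\<close>

lemma free_algebra:
  assumes "X \<in> Ob C"
  shows "is_algebra C M (FOb M X) (mmult C M X)"
  using assms by (simp add: is_algebra_def mmult_hom mmult_munit mmult_mmult)

section \<open>Strengths and tensors on elements\<close>

lemma
  assumes "X \<in> Ob C" "Y \<in> Ob C"
  shows Arr_strength_l [simp]: "strength_l C M X Y \<in> Arr C"
    and Dom_strength_l [simp]: "Dom C (strength_l C M X Y) = Prod C (FOb M X) Y"
    and Cod_strength_l [simp]: "Cod C (strength_l C M X Y) = FOb M (Prod C X Y)"
    and Arr_strength_r [simp]: "strength_r C M X Y \<in> Arr C"
    and Dom_strength_r [simp]: "Dom C (strength_r C M X Y) = Prod C X (FOb M Y)"
    and Cod_strength_r [simp]: "Cod C (strength_r C M X Y) = FOb M (Prod C X Y)"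
  using assms by (simp_all add: strength_l_def strength_r_def)

lemma
  assumes "X \<in> Ob C" "Y \<in> Ob C"
  shows tensor_hom: "tensor C M X Y \<in> hom C (Prod C (FOb M X) (FOb M Y)) (FOb M (Prod C X Y))"
    and tensor'_hom: "tensor' C M X Y \<in> hom C (Prod C (FOb M X) (FOb M Y)) (FOb M (Prod C X Y))"
  using assms by (simp_all add: tensor_def tensor'_def hom_def)

lemma Ev_FHom_mor_name:
  assumes "f \<in> hom C X Y" "\<mu> \<in> elts C (FOb M X)"
  shows "Ev C (FOb M X) (FOb M Y) \<cdot> \<langle>FHom M X Y \<cdot> mor_name C f, \<mu>\<rangle> = mmap C M f \<cdot> \<mu>"
  using assms Ob_of_hom[OF assms(1)] homD[OF assms(1)]
  by (simp add: mmap_def named_mor_Comp FHom_elt mor_name_hom)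

text \<open>The transposed symmetry after \<open>y\<close> is the name of the section sending
  \<open>x\<close> to \<open>(x, y)\<close>, since both evaluate to that pair. \<open>FHom\<close>
  of this name, evaluated at \<open>\<mu>\<close>, is \<open>mmap\<close> of the section.\<close>

lemma strength_l_pair:
  assumes "X \<in> Ob C" "\<mu> \<in> elts C (FOb M X)" "y \<in> elts C Y"
  shows "strength_l C M X Y \<cdot> \<langle>\<mu>, y\<rangle> = mmap C M \<langle>Id C X, y \<cdot> bang C X\<rangle> \<cdot> \<mu>"
proof -
  have Y: "Y \<in> Ob C" and y: "y \<in> Arr C" "Dom C y = \<one>" "Cod C y = Y"
    using assms(3) Ob_of_hom homD by auto
  have h: "\<langle>Id C X, y \<cdot> bang C X\<rangle> \<in> hom C X (Prod C X Y)"
    using assms(1) y by (simp add: hom_def)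
  have "curry C Y X (swap C Y X) \<cdot> y = mor_name C \<langle>Id C X, y \<cdot> bang C X\<rangle>"
  proof (rule elts_Exp_ext)
    fix x assume "x \<in> elts C X"
    then show "Ev C X (Prod C X Y) \<cdot> \<langle>curry C Y X (swap C Y X) \<cdot> y, x\<rangle> =
        Ev C X (Prod C X Y) \<cdot> \<langle>mor_name C \<langle>Id C X, y \<cdot> bang C X\<rangle>, x\<rangle>"
      using assms(1) Y y by (subst Ev_mor_name[OF h]) (auto simp: hom_def)
  qed (use assms(1) Y y in \<open>auto simp: hom_def\<close>)
  then have "strength_l C M X Y \<cdot> \<langle>\<mu>, y\<rangle> = Ev C (FOb M X) (FOb M (Prod C X Y)) \<cdot>
      \<langle>FHom M X (Prod C X Y) \<cdot> mor_name C \<langle>Id C X, y \<cdot> bang C X\<rangle>, \<mu>\<rangle>"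
    using assms(1,2) Y y by (simp add: strength_l_def hom_def)
  then show ?thesis
    using Ev_FHom_mor_name[OF h assms(2)] by simp
qed

text \<open>The mirror image: the transposed identity after \<open>x\<close> names the section
  sending \<open>y\<close> to \<open>(x, y)\<close>.\<close>

lemma strength_r_pair:
  assumes "Y \<in> Ob C" "x \<in> elts C X" "\<nu> \<in> elts C (FOb M Y)"
  shows "strength_r C M X Y \<cdot> \<langle>x, \<nu>\<rangle> = mmap C M \<langle>x \<cdot> bang C Y, Id C Y\<rangle> \<cdot> \<nu>"
proof -
  have X: "X \<in> Ob C" and x: "x \<in> Arr C" "Dom C x = \<one>" "Cod C x = X"
    using assms(2) Ob_of_hom homD by auto
  have h: "\<langle>x \<cdot> bang C Y, Id C Y\<rangle> \<in> hom C Y (Prod C X Y)"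
    using assms(1) x by (simp add: hom_def)
  have "curry C X Y (Id C (Prod C X Y)) \<cdot> x = mor_name C \<langle>x \<cdot> bang C Y, Id C Y\<rangle>"
  proof (rule elts_Exp_ext)
    fix y assume "y \<in> elts C Y"
    then show "Ev C Y (Prod C X Y) \<cdot> \<langle>curry C X Y (Id C (Prod C X Y)) \<cdot> x, y\<rangle> =
        Ev C Y (Prod C X Y) \<cdot> \<langle>mor_name C \<langle>x \<cdot> bang C Y, Id C Y\<rangle>, y\<rangle>"
      using assms(1) X x by (subst Ev_mor_name[OF h]) (auto simp: hom_def)
  qed (use assms(1) X x in \<open>auto simp: hom_def\<close>)
  then have "strength_r C M X Y \<cdot> \<langle>x, \<nu>\<rangle> = Ev C (FOb M Y) (FOb M (Prod C X Y)) \<cdot>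
      \<langle>FHom M Y (Prod C X Y) \<cdot> mor_name C \<langle>x \<cdot> bang C Y, Id C Y\<rangle>, \<nu>\<rangle>"
    using assms(1,3) X x by (simp add: strength_r_def hom_def)
  then show ?thesis
    using Ev_FHom_mor_name[OF h assms(3)] by simp
qed

section \<open>Iterated integrals as integrals against the two tensors\<close>

lemma algebra_mmult:
  assumes "is_algebra C M Z a" "f \<in> hom C W Z" "h \<in> hom C V (FOb M W)" "w \<in> elts C (FOb M V)"
  shows "a \<cdot> mmap C M f \<cdot> mmult C M W \<cdot> mmap C M h \<cdot> w = a \<cdot> mmap C M (a \<cdot> mmap C M f \<cdot> h) \<cdot> w"
proof -
  have Ob: "Z \<in> Ob C" "W \<in> Ob C" "V \<in> Ob C"
    using Ob_of_hom[OF assms(2)] Ob_of_hom[OF assms(3)] by auto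
  note [simp] = homD[OF assms(2)] homD[OF assms(3)] homD[OF assms(4)]
  have [simp]: "a \<in> Arr C" "Dom C a = FOb M Z" "Cod C a = Z"
    using assms(1) by (auto simp: is_algebra_def hom_def)
  \<comment> \<open>In the applications \<open>h\<close> is a strength with one argument held
    constant and \<open>w\<close> is the measure of the outer integral. The parentheses isolate the
    two factors that naturality exchanges; this brings \<open>mmult\<close> next to
    \<open>a\<close>.\<close>
  have "a \<cdot> mmap C M f \<cdot> mmult C M W \<cdot> mmap C M h \<cdot> w =
      a \<cdot> (mmap C M f \<cdot> mmult C M W) \<cdot> mmap C M h \<cdot> w"
    using Ob by simp
  also have "\<dots> = (a \<cdot> mmult C M Z) \<cdot> mmap C M (mmap C M f) \<cdot> mmap C M h \<cdot> w"
    using Ob by (simp add: mmult_natural[OF assms(2)])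
  also have "a \<cdot> mmult C M Z = a \<cdot> mmap C M a"
    using assms(1) by (simp add: is_algebra_def)
  finally show ?thesis
    using Ob by simp
qed

lemma iterated_integral_tensor:
  assumes "is_algebra C M Z a" "X \<in> Ob C" "Y \<in> Ob C" "f \<in> hom C (Prod C X Y) Z"
    "\<mu> \<in> elts C (FOb M X)" "\<nu> \<in> elts C (FOb M Y)"
  shows "integral_fun C M Y Z a (\<lambda>y. integral_fun C M X Z a (\<lambda>x. f \<cdot> \<langle>x, y\<rangle>) \<mu>) \<nu> =
    integral C M a f (tensor C M X Y \<cdot> \<langle>\<mu>, \<nu>\<rangle>)"
proof -
  note [simp] = assms(2,3) homD[OF assms(4)] homD[OF assms(5)] homD[OF assms(6)]
  have [simp]: "Z \<in> Ob C" "a \<in> Arr C" "Dom C a = FOb M Z" "Cod C a = Z"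
    using assms(1) by (auto simp: is_algebra_def hom_def)
  \<comment> \<open>\<open>\<mu> \<cdot> bang C Y\<close> is the constant morphism at
    \<open>\<mu>\<close>, so \<open>g\<close> is the inner integral as a morphism in
    \<open>y\<close>.\<close>
  define g where "g = a \<cdot> mmap C M f \<cdot> strength_l C M X Y \<cdot> \<langle>\<mu> \<cdot> bang C Y, Id C Y\<rangle>"
  have "mor_of_fun C Y Z (\<lambda>y. integral_fun C M X Z a (\<lambda>x. f \<cdot> \<langle>x, y\<rangle>) \<mu>) = g"
  proof (rule mor_of_fun_eq)
    show "g \<in> hom C Y Z"
      by (simp add: g_def hom_def)
    fix y assume y: "y \<in> elts C Y"
    note [simp] = homD[OF y]
    \<comment> \<open>For fixed \<open>y\<close> the integrand is \<open>f\<close> restricted along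
      the section at \<open>y\<close>, the same section that \<open>strength_l_pair\<close>
      produces.\<close>
    have "mor_of_fun C X Z (\<lambda>x. f \<cdot> \<langle>x, y\<rangle>) = f \<cdot> \<langle>Id C X, y \<cdot> bang C X\<rangle>"
      by (rule mor_of_fun_eq) (auto simp: hom_def)
    then show "g \<cdot> y = integral_fun C M X Z a (\<lambda>x. f \<cdot> \<langle>x, y\<rangle>) \<mu>"
      using y assms(5) by (simp add: g_def integral_fun_def integral_def strength_l_pair)
  qed
  moreover have "\<mu> \<cdot> bang C Y \<in> hom C Y (FOb M X)"
    by (simp add: hom_def)
  \<comment> \<open>\<open>strength_r_pair\<close> is used with \<open>\<mu>\<close> as an element
    of the object \<open>M X\<close>; functoriality then merges the resulting section with
    \<open>strength_l\<close> under a single \<open>mmap\<close>.\<close>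
  moreover have "integral C M a f (tensor C M X Y \<cdot> \<langle>\<mu>, \<nu>\<rangle>) = a \<cdot> mmap C M f \<cdot>
      mmult C M (Prod C X Y) \<cdot> mmap C M (strength_l C M X Y \<cdot> \<langle>\<mu> \<cdot> bang C Y, Id C Y\<rangle>) \<cdot> \<nu>"
    using strength_r_pair[OF _ assms(5,6)] by (simp add: integral_def tensor_def)
  moreover have "\<dots> = a \<cdot> mmap C M g \<cdot> \<nu>"
    unfolding g_def
    by (rule algebra_mmult[OF assms(1,4) _ assms(6)]) (simp add: hom_def)
  moreover have "g \<in> Arr C" "Dom C g = Y" "Cod C g = Z"
    by (simp_all add: g_def)
  ultimately show ?thesis
    by (simp add: integral_fun_def integral_def)
qed

text \<open>As before with the strengths exchanged: now \<open>\<nu>\<close> is the constant, and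
  the outer integral is against \<open>\<mu>\<close>.\<close>

lemma iterated_integral_tensor':
  assumes "is_algebra C M Z a" "X \<in> Ob C" "Y \<in> Ob C" "f \<in> hom C (Prod C X Y) Z"
    "\<mu> \<in> elts C (FOb M X)" "\<nu> \<in> elts C (FOb M Y)"
  shows "integral_fun C M X Z a (\<lambda>x. integral_fun C M Y Z a (\<lambda>y. f \<cdot> \<langle>x, y\<rangle>) \<nu>) \<mu> =
    integral C M a f (tensor' C M X Y \<cdot> \<langle>\<mu>, \<nu>\<rangle>)"
proof -
  note [simp] = assms(2,3) homD[OF assms(4)] homD[OF assms(5)] homD[OF assms(6)]
  have [simp]: "Z \<in> Ob C" "a \<in> Arr C" "Dom C a = FOb M Z" "Cod C a = Z"
    using assms(1) by (auto simp: is_algebra_def hom_def)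
  define g where "g = a \<cdot> mmap C M f \<cdot> strength_r C M X Y \<cdot> \<langle>Id C X, \<nu> \<cdot> bang C X\<rangle>"
  have "mor_of_fun C X Z (\<lambda>x. integral_fun C M Y Z a (\<lambda>y. f \<cdot> \<langle>x, y\<rangle>) \<nu>) = g"
  proof (rule mor_of_fun_eq)
    show "g \<in> hom C X Z"
      by (simp add: g_def hom_def)
    fix x assume x: "x \<in> elts C X"
    note [simp] = homD[OF x]
    have "mor_of_fun C Y Z (\<lambda>y. f \<cdot> \<langle>x, y\<rangle>) = f \<cdot> \<langle>x \<cdot> bang C Y, Id C Y\<rangle>"
      by (rule mor_of_fun_eq) (auto simp: hom_def)
    then show "g \<cdot> x = integral_fun C M Y Z a (\<lambda>y. f \<cdot> \<langle>x, y\<rangle>) \<nu>"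
      using x assms(6) by (simp add: g_def integral_fun_def integral_def strength_r_pair)
  qed
  moreover have "integral C M a f (tensor' C M X Y \<cdot> \<langle>\<mu>, \<nu>\<rangle>) = a \<cdot> mmap C M f \<cdot>
      mmult C M (Prod C X Y) \<cdot> mmap C M (strength_r C M X Y \<cdot> \<langle>Id C X, \<nu> \<cdot> bang C X\<rangle>) \<cdot> \<mu>"
    using strength_l_pair[OF _ assms(5,6)] by (simp add: integral_def tensor'_def)
  moreover have "\<dots> = a \<cdot> mmap C M g \<cdot> \<mu>"
    unfolding g_def
    by (rule algebra_mmult[OF assms(1,4) _ assms(5)]) (simp add: hom_def)
  moreover have "g \<in> Arr C" "Dom C g = X" "Cod C g = Z"
    by (simp_all add: g_def)
  ultimately show ?thesis
    by (simp add: integral_fun_def integral_def)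
qed

text \<open>The unit law \<open>mmult_mmap_munit\<close>. Integrating the unit in the free algebra
  therefore separates elements of \<open>M X\<close>.\<close>

lemma integral_munit:
  assumes "X \<in> Ob C" "\<mu> \<in> elts C (FOb M X)"
  shows "integral C M (mmult C M X) (munit C M X) \<mu> = \<mu>"
  using assms by (auto simp: integral_def mmult_mmap_munit hom_def)

end

theorem corollary8p7p4:
  fixes \<X> :: "('o, 'm, 'z) ccc_scheme" (structure)
    and \<M> :: "('o, 'm, 'y) emonad_scheme"
  assumes "well_pointed_ccc \<X>"
    and "enriched_monad \<X> (self_enriched \<X>) \<M>"
  shows "commutative_monad \<X> \<M> \<longleftrightarrow>
    (\<forall>Z a X Y f \<mu> \<nu>.
      is_algebra \<X> \<M> Z a \<longrightarrow> X \<in> Ob \<X> \<longrightarrow> Y \<in> Ob \<X> \<longrightarrow> f \<in> hom \<X> (Prod \<X> X Y) Z \<longrightarrow>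
      \<mu> \<in> elts \<X> (FOb \<M> X) \<longrightarrow> \<nu> \<in> elts \<X> (FOb \<M> Y) \<longrightarrow>
        integral_fun \<X> \<M> Y Z a (\<lambda>y. integral_fun \<X> \<M> X Z a (\<lambda>x. f \<cdot> \<langle>x, y\<rangle>) \<mu>) \<nu> =
          integral \<X> \<M> a f (tensor \<X> \<M> X Y \<cdot> \<langle>\<mu>, \<nu>\<rangle>) \<and>
        integral \<X> \<M> a f (tensor \<X> \<M> X Y \<cdot> \<langle>\<mu>, \<nu>\<rangle>) =
          integral_fun \<X> \<M> X Z a (\<lambda>x. integral_fun \<X> \<M> Y Z a (\<lambda>y. f \<cdot> \<langle>x, y\<rangle>) \<nu>) \<mu>)"
    (is "_ \<longleftrightarrow> ?fubini")
proof
  interpret well_pointed_monad \<X> \<M>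
    using assms by (simp add: well_pointed_monad_def)
  \<comment> \<open>Each iterated integral is the integral against its own tensor, and commutativity
    makes the two tensors equal.\<close>
  show ?fubini if "commutative_monad \<X> \<M>"
    using that by (simp add: commutative_monad_def iterated_integral_tensor iterated_integral_tensor')
  assume fubini: ?fubini
  show "commutative_monad \<X> \<M>"
    unfolding commutative_monad_def
  proof (intro ballI)
    fix X Y assume X: "X \<in> Ob \<X>" and Y: "Y \<in> Ob \<X>"
    let ?P = "Prod \<X> X Y"
    have P: "?P \<in> Ob \<X>" using X Y by simp
    show "tensor \<X> \<M> X Y = tensor' \<X> \<M> X Y"
    proof (rule prod_mor_ext[OF tensor_hom[OF X Y] tensor'_hom[OF X Y]])
      fix \<mu> \<nu> assume \<mu>\<nu>: "\<mu> \<in> elts \<X> (FOb \<M> X)" "\<nu> \<in> elts \<X> (FOb \<M> Y)"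
      then have mn: "\<langle>\<mu>, \<nu>\<rangle> \<in> elts \<X> (Prod \<X> (FOb \<M> X) (FOb \<M> Y))"
        by (simp add: hom_def)
      \<comment> \<open>The hypothesis at the free algebra on the product, with the unit as
        integrand; its last iterated integral is the integral against
        \<open>tensor'\<close>.\<close>
      have "integral \<X> \<M> (mmult \<X> \<M> ?P) (munit \<X> \<M> ?P) (tensor \<X> \<M> X Y \<cdot> \<langle>\<mu>, \<nu>\<rangle>) =
          integral \<X> \<M> (mmult \<X> \<M> ?P) (munit \<X> \<M> ?P) (tensor' \<X> \<M> X Y \<cdot> \<langle>\<mu>, \<nu>\<rangle>)"
        using fubini free_algebra[OF P] X Y munit_hom[OF P] \<mu>\<nu>
        by (metis iterated_integral_tensor')
      then show "tensor \<X> \<M> X Y \<cdot> \<langle>\<mu>, \<nu>\<rangle> = tensor' \<X> \<M> X Y \<cdot> \<langle>\<mu>, \<nu>\<rangle>"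
        using P Comp_hom[OF mn tensor_hom[OF X Y]] Comp_hom[OF mn tensor'_hom[OF X Y]]
        by (simp add: integral_munit)
    qed (use X Y in simp_all)
  qed
qed

end
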